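(* Assume: (a) $U(u,t)$ is nondecreasing in $u$ and in $t$, and $\lim_{t\to+\infty}U(u,t)=+\infty$ for every $u\ge0$; (b) there exist constants $u_*\ge0$, $c_*>0$, $L>0$ such that $U(u,t)\ge u+c_*t$ for all $u\ge u_*$, $t\ge 0$, and $(\alpha/c_* )\int_0^{+\infty}e^{Lz}[1-F(z)]\,dz\le1$. Put $\varphi_*(u)=\max\{0,1-e^{-L(u-u_* )}\}$. Then: 1) the equation $\varphi=A\varphi$ has a nondecreasing solution $\varphi$ with $1\ge\varphi(u)\ge\varphi_*(u)$ for all $u\ge0$; 2) $\varphi$ is the unique nondecreasing solution $[0,+\infty)\to[0,1]$ of $\varphi=A\varphi$ satisfying $\lim_{u\to+\infty}\varphi(u)=1$; 3) for any initial function $\varphi^0$ with $1\ge\varphi^0(u)\ge\varphi_*(u)$ for all $u\ge0$, the sequence $\varphi^{k+1}=A\varphi^k$, $k=0,1,\dots$, converges pointwise to $\varphi$.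
   Context: $\alpha>0$ is the intensity of the Poisson claim flow; $F$ is the distribution function of claim sizes, $F(z)=0$ for $z\le0$, with finite mean $\mu$. $c(\cdot)\ge0$ is a piecewise continuous premium rate and $U(u,t)$, $u,t\ge0$, is the solution of the Cauchy problem $dU/dt=c(U)$, $U(u,0)=u$, assumed well defined for all $t\ge0$. The operator $A$ acts on bounded Borel functions $\varphi:[0,+\infty)\to\mathbb R$ by $$A\varphi(u)=\int_0^{+\infty}\alpha e^{-\alpha t}\int_0^{U(u,t)}\varphi(U(u,t)-z)\,dF(z)\,dt,\qquad u\ge0,$$ where the inner integral is a Lebesgue–Stieltjes integral over $[0,U(u,t)]$. All initial functions are Borel measurable. *)

theory Defs
  imports "HOL-Probability.Probability"
begin

definition distribution_function :: "(real \<Rightarrow> real) \<Rightarrow> bool" where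
  "distribution_function F \<longleftrightarrow>
     mono F \<and> (\<forall>x. continuous (at_right x) F) \<and>
     (F \<longlongrightarrow> 0) at_bot \<and> (F \<longlongrightarrow> 1) at_top"

text \<open>Functions on the half-line \<open>[0, \<infinity>)\<close> are total functions on the reals whose values
  at negative arguments are irrelevant.\<close>

definition piecewise_continuous_half_line :: "(real \<Rightarrow> real) \<Rightarrow> bool" where
  "piecewise_continuous_half_line c \<longleftrightarrow>
     (\<exists>D. (\<forall>b. finite (D \<inter> {0..b})) \<and>
          (\<forall>x\<in>{0..} - D. continuous (at x within {0..}) c) \<and>
          (\<forall>x\<in>{0..} \<inter> D. (\<exists>l. (c \<longlongrightarrow> l) (at_right x)) \<and>
                          (0 < x \<longrightarrow> (\<exists>l. (c \<longlongrightarrow> l) (at_left x)))))"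

text \<open>A global solution of \<open>dx/dt = c(x)\<close>, \<open>x(0) = u\<close>. As \<open>c\<close> may jump, a solution
  may have kinks: it is continuous, and the differential equation holds outside a locally
  finite set of times.\<close>

definition cauchy_solution :: "(real \<Rightarrow> real) \<Rightarrow> real \<Rightarrow> (real \<Rightarrow> real) \<Rightarrow> bool" where
  "cauchy_solution c u x \<longleftrightarrow>
     continuous_on {0..} x \<and> (\<forall>t\<ge>0. 0 \<le> x t) \<and> x 0 = u \<and>
     (\<exists>S. (\<forall>T. finite (S \<inter> {0..T})) \<and>
          (\<forall>t\<in>{0..} - S. (x has_real_derivative c (x t)) (at t within {0..})))"

definition is_flow :: "(real \<Rightarrow> real) \<Rightarrow> (real \<Rightarrow> real \<Rightarrow> real) \<Rightarrow> bool" where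
  "is_flow c U \<longleftrightarrow>
     (\<forall>u\<ge>0. cauchy_solution c u (U u) \<and>
             (\<forall>x. cauchy_solution c u x \<longrightarrow> (\<forall>t\<ge>0. x t = U u t)))"

definition opA :: "real \<Rightarrow> (real \<Rightarrow> real) \<Rightarrow> (real \<Rightarrow> real \<Rightarrow> real) \<Rightarrow> (real \<Rightarrow> real) \<Rightarrow> real \<Rightarrow> real"
  where
  "opA \<alpha> F U \<phi> u =
     (LINT t:{0..}|lborel. \<alpha> * exp (- \<alpha> * t) *
        (LINT z:{0..U u t}|interval_measure F. \<phi> (U u t - z)))"

definition phi_star :: "real \<Rightarrow> real \<Rightarrow> real \<Rightarrow> real" where
  "phi_star L us u = max 0 (1 - exp (- L * (u - us)))"

definition nondecreasing_solution ::
  "real \<Rightarrow> (real \<Rightarrow> real) \<Rightarrow> (real \<Rightarrow> real \<Rightarrow> real) \<Rightarrow> (real \<Rightarrow> real) \<Rightarrow> bool" where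
  "nondecreasing_solution \<alpha> F U \<phi> \<longleftrightarrow>
     mono_on {0..} \<phi> \<and> (\<forall>u\<ge>0. \<phi> u = opA \<alpha> F U \<phi> u)"

end

theory Submission
  imports Defs
begin

text \<open>With \<open>T\<close> exponentially distributed and \<open>Z\<close> an independent claim, \<open>A\<phi>(u)\<close> is the expectation of
  \<open>\<phi>(U(u,T) - Z)\<close>, where \<open>\<phi>\<close> is extended by \<open>0\<close> to negative arguments. Hence \<open>A\<close> is monotone, and
  \<open>\<phi>\<^sub>* \<le> A\<phi>\<^sub>*\<close> and \<open>A1 \<le> 1\<close> make the iterates of \<open>\<phi>\<^sub>*\<close> increase and those of \<open>1\<close> decrease to fixed
  points, both with limit \<open>1\<close> at infinity. The iterates of \<open>1\<close> tend to the greatest fixed point, so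
  uniqueness amounts to showing that a nonnegative fixed point vanishing at infinity is zero. The
  two limits therefore agree and squeeze the iterates of any \<open>\<phi>\<^sup>0\<close> between \<open>\<phi>\<^sub>*\<close> and \<open>1\<close>.\<close>

section \<open>Joint measurability and a supremum argument\<close>

text \<open>Rounding \<open>t\<close> down to a grid of mesh \<open>1 / (n + 1)\<close> leaves
  countably many sections, each measurable in \<open>u\<close>; continuity in \<open>t\<close>
  recovers \<open>f\<close> as the pointwise limit. It serves the flow, which is monotone in the
  initial reserve and continuous in time.\<close>

lemma borel_measurable_caratheodory:
  fixes f :: "real \<Rightarrow> real \<Rightarrow> real"
  assumes meas: "\<And>t. (\<lambda>u. f u t) \<in> borel_measurable borel"
    and cont: "\<And>u. continuous_on UNIV (f u)"
  shows "(\<lambda>p. f (fst p) (snd p)) \<in> borel_measurable (borel \<Otimes>\<^sub>M borel)"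
proof (rule borel_measurable_LIMSEQ_real)
  define g where "g n t = real_of_int \<lfloor>real (Suc n) * t\<rfloor> / real (Suc n)" for n t
  have g: "(\<lambda>n. g n t) \<longlonglongrightarrow> t" for t
  proof (rule real_tendsto_sandwich)
    show "\<forall>\<^sub>F n in sequentially. t - inverse (real (Suc n)) \<le> g n t"
    proof (intro always_eventually allI)
      fix n
      have "t - inverse (real (Suc n)) = (real (Suc n) * t - 1) / real (Suc n)"
        by (simp add: field_simps)
      also have "\<dots> \<le> g n t"
        unfolding g_def by (intro divide_right_mono) linarith+
      finally show "t - inverse (real (Suc n)) \<le> g n t" .
    qed
    show "\<forall>\<^sub>F n in sequentially. g n t \<le> t"
    proof (intro always_eventually allI)
      fix n
      have "g n t \<le> (real (Suc n) * t) / real (Suc n)"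
        unfolding g_def by (intro divide_right_mono of_int_floor_le) simp
      then show "g n t \<le> t"
        by simp
    qed
    show "(\<lambda>n. t - inverse (real (Suc n))) \<longlonglongrightarrow> t"
      using LIMSEQ_inverse_real_of_nat_add_minus[of t] by simp
  qed simp
  show "(\<lambda>n. f (fst p) (g n (snd p))) \<longlonglongrightarrow> f (fst p) (snd p)" for p
    using cont[of "fst p"] g[of "snd p"]
    by (intro isCont_tendsto_compose[of _ "f (fst p)"])
      (auto simp: continuous_on_eq_continuous_at)
  have [measurable]: "(\<lambda>p. f (fst p) t) \<in> borel_measurable (borel \<Otimes>\<^sub>M borel)" for t
    by (rule measurable_compose[OF measurable_fst meas])
  show "(\<lambda>p. f (fst p) (g n (snd p))) \<in> borel_measurable (borel \<Otimes>\<^sub>M borel)" for n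
    unfolding g_def
    by (rule measurable_compose_countable
        [where g = "\<lambda>p. \<lfloor>real (Suc n) * snd p\<rfloor>"
          and f = "\<lambda>i p. f (fst p) (real_of_int i / real (Suc n))"]) measurable
qed

text \<open>With \<open>s\<close> the supremum of \<open>d\<close>, a positive \<open>s\<close>
  would be replaced by the smaller upper bound \<open>q\<close>. The bound must be uniform in
  \<open>u\<close>, since the supremum need not be attained.\<close>

lemma unit_interval_sup_contraction:
  fixes d :: "'a \<Rightarrow> real"
  assumes nonneg: "\<And>u. u \<in> A \<Longrightarrow> 0 \<le> d u" and le1: "\<And>u. u \<in> A \<Longrightarrow> d u \<le> 1"
    and contr: "\<And>s. 0 < s \<Longrightarrow> (\<And>u. u \<in> A \<Longrightarrow> d u \<le> s) \<Longrightarrow>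
      \<exists>q<s. \<forall>u\<in>A. d u \<le> q"
    and "u \<in> A"
  shows "d u = 0"
proof (rule ccontr)
  assume "d u \<noteq> 0"
  then have "0 < d u"
    using nonneg[OF \<open>u \<in> A\<close>] by simp
  have bdd: "bdd_above (d ` A)"
    using le1 by (auto intro!: bdd_aboveI[of _ 1])
  define s where "s = (SUP v\<in>A. d v)"
  have s: "d v \<le> s" if "v \<in> A" for v
    unfolding s_def by (rule cSUP_upper[OF that bdd])
  then obtain q where "q < s" "\<forall>v\<in>A. d v \<le> q"
    using contr[of s] \<open>0 < d u\<close> \<open>u \<in> A\<close> by (meson less_le_trans)
  then have "s \<le> q"
    unfolding s_def using \<open>u \<in> A\<close> by (intro cSUP_least) auto
  then show False
    using \<open>q < s\<close> by simp
qed

section \<open>Functions with values in the unit interval\<close>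

definition unit_fun :: "(real \<Rightarrow> real) \<Rightarrow> bool" where
  "unit_fun \<phi> \<longleftrightarrow> \<phi> \<in> borel_measurable (restrict_space borel {0..}) \<and>
    (\<forall>u\<ge>0. 0 \<le> \<phi> u \<and> \<phi> u \<le> 1)"

text \<open>The value 0 below zero is the survival probability after ruin. The product with an
  indicator is the form in which measurability on a restricted space is expressed on the whole
  line.\<close>

definition zero_ext :: "(real \<Rightarrow> real) \<Rightarrow> real \<Rightarrow> real" where
  "zero_ext \<phi> w = indicator {0..} w *\<^sub>R \<phi> w"

lemma zero_ext_simps [simp]: "0 \<le> w \<Longrightarrow> zero_ext \<phi> w = \<phi> w" "w < 0 \<Longrightarrow> zero_ext \<phi> w = 0"
  by (auto simp: zero_ext_def)

lemma borel_measurable_zero_ext_iff: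
  "zero_ext \<phi> \<in> borel_measurable borel \<longleftrightarrow>
    \<phi> \<in> borel_measurable (restrict_space borel {0..})"
  using borel_measurable_restrict_space_iff[of "{0..}" borel \<phi>]
  by (simp add: zero_ext_def[abs_def])

lemma unit_funD:
  assumes "unit_fun \<phi>"
  shows borel_measurable_zero_ext: "zero_ext \<phi> \<in> borel_measurable borel"
    and unit_fun_nonneg: "0 \<le> u \<Longrightarrow> 0 \<le> \<phi> u"
    and unit_fun_le_1: "0 \<le> u \<Longrightarrow> \<phi> u \<le> 1"
    and zero_ext_nonneg: "0 \<le> zero_ext \<phi> w"
    and zero_ext_le_1: "zero_ext \<phi> w \<le> 1"
  using assms by (auto simp: unit_fun_def borel_measurable_zero_ext_iff zero_ext_def
    split: split_indicator)

lemma unit_fun_mono_on: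
  assumes "mono_on {0..} \<phi>" "\<And>u. 0 \<le> u \<Longrightarrow> 0 \<le> \<phi> u" "\<And>u. 0 \<le> u \<Longrightarrow> \<phi> u \<le> 1"
  shows "unit_fun \<phi>"
  using assms borel_measurable_mono_on_fnc[of "{0..}" \<phi>] by (auto simp: unit_fun_def)

lemma unit_fun_diff:
  assumes "unit_fun \<phi>" "unit_fun \<psi>" "\<And>u. 0 \<le> u \<Longrightarrow> \<psi> u \<le> \<phi> u"
  shows "unit_fun (\<lambda>u. \<phi> u - \<psi> u)"
proof -
  have "\<phi> u - \<psi> u \<le> 1" if "0 \<le> u" for u
    using unit_fun_le_1[OF assms(1) that] unit_fun_nonneg[OF assms(2) that] by simp
  then show ?thesis
    using assms unfolding unit_fun_def by (auto intro!: borel_measurable_diff)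
qed

lemma unit_fun_LIMSEQ:
  assumes "\<And>k. unit_fun (\<phi> k)" "\<And>u. 0 \<le> u \<Longrightarrow> (\<lambda>k. \<phi> k u) \<longlonglongrightarrow> \<psi> u"
  shows "unit_fun \<psi>"
  unfolding unit_fun_def
proof (intro conjI allI impI)
  show "\<psi> \<in> borel_measurable (restrict_space borel {0..})"
  proof (rule borel_measurable_LIMSEQ_real[where u = \<phi>])
    show "\<phi> k \<in> borel_measurable (restrict_space borel {0..})" for k
      using assms(1)[of k] by (simp add: unit_fun_def)
  qed (simp add: space_restrict_space assms(2))
  show "0 \<le> \<psi> u" if "0 \<le> u" for u
    using assms(2)[OF that] unit_fun_nonneg[OF assms(1) that]
    by (intro LIMSEQ_le_const) auto
  show "\<psi> u \<le> 1" if "0 \<le> u" for u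
    using assms(2)[OF that] unit_fun_le_1[OF assms(1) that]
    by (intro LIMSEQ_le_const2) auto
qed

section \<open>Laws of the waiting time and the claim\<close>

text \<open>Monotonicity in \<open>u\<close> and continuity in \<open>t\<close> make the flow
  jointly measurable; nonnegativity keeps the reserve before a claim on the half-line. Growth
  conditions on the flow are stated in the lemmas that use them.\<close>

locale risk_process =
  fixes \<alpha> :: real and F :: "real \<Rightarrow> real" and U :: "real \<Rightarrow> real \<Rightarrow> real"
  assumes alpha_pos: "0 < \<alpha>"
    and F_df: "distribution_function F"
    and F_zero: "z \<le> 0 \<Longrightarrow> F z = 0"
    and U_nonneg: "0 \<le> u \<Longrightarrow> 0 \<le> t \<Longrightarrow> 0 \<le> U u t"
    and U_cont: "0 \<le> u \<Longrightarrow> continuous_on {0..} (U u)"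
    and U_mono: "0 \<le> t \<Longrightarrow> mono_on {0..} (\<lambda>u. U u t)"
begin

abbreviation waiting :: "real measure" where
  "waiting \<equiv> density lborel (exponential_density \<alpha>)"

abbreviation claim :: "real measure" where
  "claim \<equiv> interval_measure F"

abbreviation waiting_claim :: "(real \<times> real) measure" where
  "waiting_claim \<equiv> waiting \<Otimes>\<^sub>M claim"

text \<open>Clamping both arguments at \<open>0\<close> removes the unconstrained values of \<open>U\<close>.\<close>

definition reserve :: "real \<Rightarrow> real \<Rightarrow> real" where
  "reserve u t = U (max 0 u) (max 0 t)"

lemma F_mono: "x \<le> y \<Longrightarrow> F x \<le> F y"
  using F_df by (simp add: distribution_function_def mono_def)

lemma F_right_cont: "continuous (at_right x) F"
  using F_df by (simp add: distribution_function_def)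

lemma F_at_bot: "(F \<longlongrightarrow> 0) at_bot"
  using F_df by (simp add: distribution_function_def)

lemma F_at_top: "(F \<longlongrightarrow> 1) at_top"
  using F_df by (simp add: distribution_function_def)

lemma prob_space_claim: "prob_space claim"
  using real_distribution_interval_measure[of F] F_mono F_right_cont F_at_bot F_at_top
  by (simp add: real_distribution_def)

lemma prob_space_waiting: "prob_space waiting"
  by (rule prob_space_exponential_density[OF alpha_pos])

sublocale claim: prob_space claim
  by (rule prob_space_claim)

sublocale waiting: prob_space waiting
  by (rule prob_space_waiting)

sublocale waiting_claim: pair_prob_space waiting claim ..

lemma emeasure_claim_atMost: "emeasure claim {..x} = F x"
  using emeasure_interval_measure_Iic[of F x] F_mono F_right_cont F_at_bot by simp

lemma measure_claim_atMost: "measure claim {..x} = F x"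
  using measure_interval_measure_Iic[of F x] F_mono F_right_cont F_at_bot by simp

lemma AE_claim_pos: "AE z in claim. 0 < z"
proof (rule AE_I)
  show "{z \<in> space claim. \<not> 0 < z} \<subseteq> {..0}"
    by auto
  show "emeasure claim {..0} = 0"
    by (simp add: emeasure_claim_atMost F_zero)
qed simp

lemma AE_waiting_nonneg: "AE t in waiting. 0 \<le> t"
  by (subst AE_density) (auto simp: exponential_density_def)

lemma AE_waiting_claim: "AE p in waiting_claim. 0 \<le> fst p \<and> 0 < snd p"
proof -
  have "AE p in waiting_claim. 0 \<le> fst p"
  proof (rule waiting_claim.AE_pair_measure)
    show "{p \<in> space waiting_claim. 0 \<le> fst p} \<in> sets waiting_claim"
      by measurable
  qed (use AE_waiting_nonneg in auto)
  moreover have "AE p in waiting_claim. 0 < snd p"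
  proof (rule waiting_claim.AE_pair_measure)
    show "{p \<in> space waiting_claim. 0 < snd p} \<in> sets waiting_claim"
      by measurable
  qed (use AE_claim_pos in auto)
  ultimately show ?thesis
    by eventually_elim simp
qed

lemma reserve_nonneg: "0 \<le> reserve u t"
  unfolding reserve_def by (intro U_nonneg) auto

lemma reserve_mono: "u \<le> v \<Longrightarrow> reserve u t \<le> reserve v t"
  unfolding reserve_def by (rule mono_onD[OF U_mono]) auto

lemma borel_measurable_reserve_pair [measurable]:
  "(\<lambda>p. reserve (fst p) (snd p)) \<in> borel_measurable (borel \<Otimes>\<^sub>M borel)"
proof (rule borel_measurable_caratheodory)
  show "(\<lambda>u. reserve u t) \<in> borel_measurable borel" for t
    by (rule borel_measurable_mono) (simp add: mono_def reserve_mono)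
  show "continuous_on UNIV (reserve u)" for u
    unfolding reserve_def
    by (rule continuous_on_compose2[OF U_cont]) (auto intro!: continuous_intros)
qed

lemma borel_measurable_reserve [measurable (raw)]:
  assumes "f \<in> borel_measurable M" "g \<in> borel_measurable M"
  shows "(\<lambda>x. reserve (f x) (g x)) \<in> borel_measurable M"
  using measurable_compose[OF measurable_Pair[OF assms] borel_measurable_reserve_pair] by simp

section \<open>The operator as an expectation, and its fixed points\<close>

text \<open>A random variable on the product space of waiting time and claim; it is negative exactly
  when that claim causes ruin.\<close>

definition after_claim :: "real \<Rightarrow> real \<times> real \<Rightarrow> real" where
  "after_claim u p = reserve u (fst p) - snd p"

lemma borel_measurable_after_claim [measurable]:
  "after_claim u \<in> borel_measurable waiting_claim"
  unfolding after_claim_def[abs_def] by measurable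

lemma integrable_after_claim:
  assumes "unit_fun \<phi>"
  shows "integrable waiting_claim (\<lambda>p. zero_ext \<phi> (after_claim u p))"
proof (rule waiting_claim.P.integrable_const_bound[of _ 1])
  show "AE p in waiting_claim. norm (zero_ext \<phi> (after_claim u p)) \<le> 1"
    using zero_ext_nonneg[OF assms] zero_ext_le_1[OF assms] by simp
  show "(\<lambda>p. zero_ext \<phi> (after_claim u p)) \<in> borel_measurable waiting_claim"
    by (rule measurable_compose[OF borel_measurable_after_claim borel_measurable_zero_ext[OF assms]])
qed

text \<open>The zero extension absorbs the cut-off at \<open>U u t\<close>, the exponential weight
  becomes the law of the waiting time, and Fubini applies because the integrand is bounded. Order,
  linearity and limits for the operator then reduce to those of one integral.\<close>

lemma opA_eq:
  assumes \<phi>: "unit_fun \<phi>" and u: "0 \<le> u"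
  shows "opA \<alpha> F U \<phi> u = (\<integral>p. zero_ext \<phi> (after_claim u p) \<partial>waiting_claim)"
proof -
  note [measurable] = borel_measurable_zero_ext[OF \<phi>]
  have inner: "(LINT z:{0..U u t}|claim. \<phi> (U u t - z)) = (\<integral>z. zero_ext \<phi> (reserve u t - z) \<partial>claim)"
    if "0 \<le> t" for t
    unfolding set_lebesgue_integral_def
  proof (rule integral_cong_AE)
    \<comment> \<open>The integrands may differ for negative \<open>z\<close>, but claims are almost
      surely positive.\<close>
    show "AE z in claim. indicator {0..U u t} z *\<^sub>R \<phi> (U u t - z) = zero_ext \<phi> (reserve u t - z)"
      using AE_claim_pos
      by eventually_elim (use that u in \<open>auto simp: reserve_def zero_ext_def split: split_indicator\<close>)
    \<comment> \<open>Off the half-line \<open>\<phi>\<close> may fail to be measurable, so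
      \<open>zero_ext \<phi>\<close> is used first; under the indicator the argument is nonnegative
      and the two agree.\<close>
    have "(\<lambda>z. indicator {0..U u t} z *\<^sub>R zero_ext \<phi> (U u t - z)) \<in> borel_measurable claim"
      by measurable
    also have "(\<lambda>z. indicator {0..U u t} z *\<^sub>R zero_ext \<phi> (U u t - z)) =
        (\<lambda>z. indicator {0..U u t} z *\<^sub>R \<phi> (U u t - z))"
      by (auto simp: fun_eq_iff split: split_indicator)
    finally show "(\<lambda>z. indicator {0..U u t} z *\<^sub>R \<phi> (U u t - z)) \<in> borel_measurable claim" .
  qed measurable
  have [measurable]: "(\<lambda>t. \<integral>z. zero_ext \<phi> (reserve u t - z) \<partial>claim) \<in> borel_measurable borel"
    by measurable
  have "opA \<alpha> F U \<phi> u =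
      (\<integral>t. exponential_density \<alpha> t *\<^sub>R (\<integral>z. zero_ext \<phi> (reserve u t - z) \<partial>claim) \<partial>lborel)"
    unfolding opA_def set_lebesgue_integral_def[of lborel]
    by (intro Bochner_Integration.integral_cong)
      (auto simp: exponential_density_def inner mult.commute split: split_indicator)
  also have "\<dots> = (\<integral>t. (\<integral>z. zero_ext \<phi> (reserve u t - z) \<partial>claim) \<partial>waiting)"
    using exponential_density_nonneg[OF alpha_pos]
    by (intro integral_density[symmetric]) auto
  also have "\<dots> = (\<integral>p. zero_ext \<phi> (after_claim u p) \<partial>waiting_claim)"
    using waiting_claim.integral_fst'[OF integrable_after_claim[OF \<phi>, of u]]
    by (simp add: after_claim_def)
  finally show ?thesis .
qed

lemma opA_mono:
  assumes "unit_fun \<phi>" "unit_fun \<psi>" "\<And>v. 0 \<le> v \<Longrightarrow> \<phi> v \<le> \<psi> v" "0 \<le> u"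
  shows "opA \<alpha> F U \<phi> u \<le> opA \<alpha> F U \<psi> u"
  unfolding opA_eq[OF assms(1,4)] opA_eq[OF assms(2,4)]
  by (intro integral_mono integrable_after_claim assms(1,2))
    (auto simp: zero_ext_def assms(3) split: split_indicator)

text \<open>The order between \<open>\<psi>\<close> and \<open>\<phi>\<close> keeps the difference
  in the unit interval. This is what makes the difference of two comparable fixed points a fixed
  point.\<close>

lemma opA_diff:
  assumes "unit_fun \<phi>" "unit_fun \<psi>" "\<And>v. 0 \<le> v \<Longrightarrow> \<psi> v \<le> \<phi> v" "0 \<le> u"
  shows "opA \<alpha> F U (\<lambda>v. \<phi> v - \<psi> v) u = opA \<alpha> F U \<phi> u - opA \<alpha> F U \<psi> u"
proof -
  have "zero_ext (\<lambda>v. \<phi> v - \<psi> v) w = zero_ext \<phi> w - zero_ext \<psi> w" for w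
    by (simp add: zero_ext_def right_diff_distrib)
  then show ?thesis
    using assms by (simp add: opA_eq unit_fun_diff integrable_after_claim)
qed

lemma unit_fun_opA:
  assumes "unit_fun \<phi>"
  shows "unit_fun (opA \<alpha> F U \<phi>)"
  unfolding unit_fun_def
proof (intro conjI allI impI)
  note [measurable] = borel_measurable_zero_ext[OF assms]
  have "(\<lambda>u. \<integral>p. zero_ext \<phi> (after_claim u p) \<partial>waiting_claim) \<in> borel_measurable borel"
    unfolding after_claim_def by measurable
  then have "(\<lambda>u. \<integral>p. zero_ext \<phi> (after_claim u p) \<partial>waiting_claim)
      \<in> borel_measurable (restrict_space borel {0..})"
    by (rule measurable_restrict_space1)
  then show "opA \<alpha> F U \<phi> \<in> borel_measurable (restrict_space borel {0..})"
    by (rule measurable_cong[THEN iffD1, rotated])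
      (auto simp: opA_eq[OF assms] space_restrict_space)
  show "0 \<le> opA \<alpha> F U \<phi> u" if "0 \<le> u" for u
    unfolding opA_eq[OF assms that] using zero_ext_nonneg[OF assms] by (intro Bochner_Integration.integral_nonneg) auto
  show "opA \<alpha> F U \<phi> u \<le> 1" if "0 \<le> u" for u
    unfolding opA_eq[OF assms that]
    using zero_ext_le_1[OF assms]
    by (intro waiting_claim.P.integral_le_const integrable_after_claim[OF assms]) auto
qed

lemma unit_fun_opA_iterate: "unit_fun \<phi> \<Longrightarrow> unit_fun ((opA \<alpha> F U ^^ k) \<phi>)"
  by (induction k) (auto intro: unit_fun_opA)

lemma opA_iterate_mono:
  assumes "unit_fun \<phi>" "unit_fun \<psi>" "\<And>v. 0 \<le> v \<Longrightarrow> \<phi> v \<le> \<psi> v" "0 \<le> u"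
  shows "(opA \<alpha> F U ^^ k) \<phi> u \<le> (opA \<alpha> F U ^^ k) \<psi> u"
  using \<open>0 \<le> u\<close>
  by (induction k arbitrary: u) (auto intro: opA_mono unit_fun_opA_iterate assms)

lemma mono_on_opA:
  assumes "unit_fun \<phi>" "mono_on {0..} \<phi>"
  shows "mono_on {0..} (opA \<alpha> F U \<phi>)"
proof (rule mono_onI)
  \<comment> \<open>Since \<open>\<phi>\<close> is nonnegative, the jump of the extension at 0 is
    upward and monotonicity extends to the whole line.\<close>
  have mono: "zero_ext \<phi> x \<le> zero_ext \<phi> y" if "x \<le> y" for x y
    using that mono_onD[OF assms(2), of x y] zero_ext_nonneg[OF assms(1), of y]
    by (cases "0 \<le> x") auto
  fix u v :: real
  assume uv: "u \<in> {0..}" "v \<in> {0..}" "u \<le> v"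
  then show "opA \<alpha> F U \<phi> u \<le> opA \<alpha> F U \<phi> v"
    using assms(1)
    by (auto simp: opA_eq after_claim_def reserve_mono
        intro!: integral_mono integrable_after_claim[unfolded after_claim_def] mono)
qed

lemma mono_on_opA_iterate:
  "unit_fun \<phi> \<Longrightarrow> mono_on {0..} \<phi> \<Longrightarrow> mono_on {0..} ((opA \<alpha> F U ^^ k) \<phi>)"
  by (induction k) (auto intro: mono_on_opA unit_fun_opA_iterate)

text \<open>Dominated convergence with the constant 1, integrable for a probability measure. It
  turns pointwise limits of iterates into fixed points.\<close>

lemma opA_LIMSEQ:
  assumes \<phi>: "\<And>k. unit_fun (\<phi> k)" and lim: "\<And>v. 0 \<le> v \<Longrightarrow> (\<lambda>k. \<phi> k v) \<longlonglongrightarrow> \<psi> v"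
    and "0 \<le> u"
  shows "(\<lambda>k. opA \<alpha> F U (\<phi> k) u) \<longlonglongrightarrow> opA \<alpha> F U \<psi> u"
proof -
  have \<psi>: "unit_fun \<psi>"
    using \<phi> lim by (rule unit_fun_LIMSEQ)
  have "(\<lambda>k. \<integral>p. zero_ext (\<phi> k) (after_claim u p) \<partial>waiting_claim)
      \<longlonglongrightarrow> (\<integral>p. zero_ext \<psi> (after_claim u p) \<partial>waiting_claim)"
  proof (rule integral_dominated_convergence[where w = "\<lambda>_. 1"])
    show "AE p in waiting_claim. (\<lambda>k. zero_ext (\<phi> k) (after_claim u p))
        \<longlonglongrightarrow> zero_ext \<psi> (after_claim u p)"
      by (auto simp: zero_ext_def lim split: split_indicator)
  qed (use zero_ext_nonneg[OF \<phi>] zero_ext_le_1[OF \<phi>] in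
      \<open>auto intro: borel_measurable_integrable integrable_after_claim \<phi> \<psi>\<close>)
  then show ?thesis
    using \<phi> \<psi> \<open>0 \<le> u\<close> by (simp add: opA_eq)
qed

text \<open>From every initial reserve, the next post-claim reserve exceeds \<open>N\<close> with a probability bounded away
  from \<open>0\<close>. Hence a fixed point that is small beyond \<open>N\<close> cannot come close to its supremum.\<close>

lemma opA_fixed_point_vanishing:
  assumes d: "unit_fun d" and fp: "\<And>u. 0 \<le> u \<Longrightarrow> d u = opA \<alpha> F U d u"
    and lim: "(d \<longlongrightarrow> 0) at_top"
    and U_mono_t: "mono_on {0..} (U 0)" and U_lim: "filterlim (U 0) at_top at_top"
    and "0 \<le> u"
  shows "d u = 0"
proof (rule unit_interval_sup_contraction[of "{0..}" d])
  fix s :: real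
  assume "0 < s" and s: "\<And>u. u \<in> {0..} \<Longrightarrow> d u \<le> s"
  have "\<forall>\<^sub>F x in at_top. d x < s / 2"
    using lim \<open>0 < s\<close> by (intro order_tendstoD) auto
  then obtain N where N: "\<And>x. N \<le> x \<Longrightarrow> d x < s / 2"
    by (auto simp: eventually_at_top_linorder)
  have "\<forall>\<^sub>F x in at_top. 0 < F x"
    using F_at_top by (intro order_tendstoD) auto
  then obtain K where K: "0 < F K"
    by (auto simp: eventually_at_top_linorder)
  have "\<forall>\<^sub>F t in at_top. max 0 N + K \<le> U 0 t \<and> 0 \<le> t"
    using U_lim eventually_ge_at_top[of 0] by (auto simp: filterlim_at_top eventually_conj_iff)
  then obtain t0 where t0: "max 0 N + K \<le> U 0 t0" "0 \<le> t0"
    by (auto simp: eventually_at_top_linorder)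
  \<comment> \<open>On \<open>E\<close> the claim comes late and is at most \<open>K\<close>. Every
    path lies above the one started at 0, so the reserve after the claim is at least
    \<open>max 0 N\<close>, whatever the initial reserve; the maximum with 0 also excludes
    ruin.\<close>
  define E where "E = {t0<..} \<times> {..K}"
  define \<delta> where "\<delta> = measure waiting_claim E"
  have E [measurable]: "E \<in> sets waiting_claim"
    unfolding E_def by (intro pair_measureI) auto
  have "emeasure waiting {..t0} = erlang_CDF 0 \<alpha> t0"
    by (rule emeasure_erlang_density[OF alpha_pos])
  then have "measure waiting {..t0} = 1 - exp (- \<alpha> * t0)"
    using t0(2) alpha_pos by (simp add: erlang_CDF_0 measure_def)
  moreover have "measure waiting (space waiting - {..t0}) = 1 - measure waiting {..t0}"
    by (rule waiting.prob_compl) simp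
  moreover have "space waiting - {..t0} = {t0<..}"
    by auto
  ultimately have "measure waiting {t0<..} = exp (- \<alpha> * t0)"
    by simp
  moreover have "\<delta> = measure waiting {t0<..} * measure claim {..K}"
    unfolding \<delta>_def E_def measure_def
    by (subst claim.emeasure_pair_measure_Times) (auto simp: enn2real_mult)
  ultimately have "0 < \<delta>"
    using K by (simp add: measure_claim_atMost)
  \<comment> \<open>The integrand is below \<open>s / 2\<close> on \<open>E\<close> and at most
    \<open>s\<close> elsewhere. As \<open>\<delta>\<close> does not depend on \<open>v\<close>, the
    gain is uniform.\<close>
  have "d v \<le> s - s / 2 * \<delta>" if v: "0 \<le> v" for v
  proof -
    have "d v = (\<integral>p. zero_ext d (after_claim v p) \<partial>waiting_claim)"
      using fp[OF v] opA_eq[OF d v] by simp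
    also have "\<dots> \<le> (\<integral>p. s - s / 2 * indicator E p \<partial>waiting_claim)"
    proof (rule integral_mono[OF integrable_after_claim[OF d]])
      show "integrable waiting_claim (\<lambda>p. s - s / 2 * indicator E p)"
        by (intro Bochner_Integration.integrable_diff integrable_mult_right integrable_real_indicator E)
          (simp_all add: waiting_claim.P.emeasure_eq_measure)
      fix p
      show "zero_ext d (after_claim v p) \<le> s - s / 2 * indicator E p"
      proof (cases "p \<in> E")
        case True
        then have p: "t0 < fst p" "snd p \<le> K"
          by (auto simp: E_def)
        have "U 0 t0 \<le> U 0 (fst p)"
          using p t0(2) by (intro mono_onD[OF U_mono_t]) auto
        also have "\<dots> \<le> reserve v (fst p)"
          using reserve_mono[OF v, of "fst p"] p t0(2) by (simp add: reserve_def)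
        finally have "max 0 N \<le> after_claim v p"
          using t0(1) p(2) unfolding after_claim_def by linarith
        then show ?thesis
          using True N[of "after_claim v p"] by simp
      next
        case False
        then show ?thesis
          using s \<open>0 < s\<close> by (simp add: zero_ext_def split: split_indicator)
      qed
    qed
    also have "\<dots> = s - s / 2 * \<delta>"
      using E by (subst Bochner_Integration.integral_diff)
        (simp_all add: \<delta>_def waiting_claim.P.emeasure_eq_measure waiting_claim.P.prob_space)
    finally show ?thesis .
  qed
  then show "\<exists>q<s. \<forall>u\<in>{0..}. d u \<le> q"
    using \<open>0 < s\<close> \<open>0 < \<delta>\<close> by (intro exI[of _ "s - s / 2 * \<delta>"]) auto
qed (use unit_fun_nonneg[OF d] unit_fun_le_1[OF d] \<open>0 \<le> u\<close> in auto)

section \<open>Exponential moments of the claim and the waiting time\<close>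

text \<open>For \<open>z > 0\<close>, \<open>exp (L * z)\<close> is 1 plus the integral of
  \<open>L * exp (L * x)\<close> over \<open>{0..<z}\<close>; Tonelli exchanges the integrals. The
  half-open interval makes the inner probability that of \<open>{x<..}\<close>, which is
  \<open>1 - F x\<close> even if \<open>F\<close> jumps at \<open>x\<close>.\<close>

lemma claim_exponential_moment:
  assumes "0 < L"
  shows "(\<integral>\<^sup>+z. exp (L * z) \<partial>claim) =
    1 + ennreal L * (\<integral>\<^sup>+x. ennreal (exp (L * x) * (1 - F x)) * indicator {0..} x \<partial>lborel)"
proof -
  interpret pair_sigma_finite lborel claim ..
  have meas: "(\<lambda>(x, z). ennreal (L * exp (L * x)) * indicator {0..<z} x)
      \<in> borel_measurable (lborel \<Otimes>\<^sub>M claim)"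
    unfolding indicator_def atLeastLessThan_iff by measurable
  have "(\<lambda>(z, x). ennreal (L * exp (L * x)) * indicator {0..<z} x)
      \<in> borel_measurable (claim \<Otimes>\<^sub>M lborel)"
    unfolding indicator_def atLeastLessThan_iff by measurable
  from lborel.borel_measurable_nn_integral_fst[OF this]
  have [measurable]: "(\<lambda>z. \<integral>\<^sup>+x. ennreal (L * exp (L * x)) * indicator {0..<z} x \<partial>lborel)
      \<in> borel_measurable claim"
    by simp
  have "(\<integral>\<^sup>+z. exp (L * z) \<partial>claim) =
      (\<integral>\<^sup>+z. 1 + (\<integral>\<^sup>+x. ennreal (L * exp (L * x)) * indicator {0..<z} x \<partial>lborel) \<partial>claim)"
  proof (rule nn_integral_cong_AE)
    show "AE z in claim. ennreal (exp (L * z)) =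
      1 + (\<integral>\<^sup>+x. ennreal (L * exp (L * x)) * indicator {0..<z} x \<partial>lborel)"
      using AE_claim_pos
    proof eventually_elim
      fix z :: real
      assume "0 < z"
      have "(\<integral>\<^sup>+x. ennreal (L * exp (L * x)) * indicator {0..<z} x \<partial>lborel) =
          (\<integral>\<^sup>+x. ennreal (L * exp (L * x)) * indicator {0..z} x \<partial>lborel)"
        by (rule nn_integral_cong_AE)
          (use AE_lborel_singleton[of z] in eventually_elim, auto split: split_indicator)
      also have "\<dots> = ennreal (exp (L * z) - exp (L * 0))"
        using \<open>0 < L\<close> \<open>0 < z\<close>
        by (intro nn_integral_FTC_Icc) (auto intro!: derivative_eq_intros)
      finally show "ennreal (exp (L * z)) =
          1 + (\<integral>\<^sup>+x. ennreal (L * exp (L * x)) * indicator {0..<z} x \<partial>lborel)"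
        using \<open>0 < L\<close> \<open>0 < z\<close> by (simp flip: ennreal_1 ennreal_plus)
    qed
  qed
  also have "\<dots> = 1 + (\<integral>\<^sup>+z. (\<integral>\<^sup>+x. ennreal (L * exp (L * x)) * indicator {0..<z} x \<partial>lborel) \<partial>claim)"
    by (subst nn_integral_add) (simp_all add: claim.emeasure_space_1[simplified])
  also have "(\<integral>\<^sup>+z. (\<integral>\<^sup>+x. ennreal (L * exp (L * x)) * indicator {0..<z} x \<partial>lborel) \<partial>claim) =
      (\<integral>\<^sup>+x. (\<integral>\<^sup>+z. ennreal (L * exp (L * x)) * indicator {0..<z} x \<partial>claim) \<partial>lborel)"
    by (rule Fubini'[OF meas])
  also have "\<dots> = (\<integral>\<^sup>+x. ennreal L * (ennreal (exp (L * x) * (1 - F x)) * indicator {0..} x) \<partial>lborel)"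
  proof (rule nn_integral_cong)
    fix x :: real
    have "measure claim (space claim - {..x}) = 1 - F x"
      by (subst claim.prob_compl) (auto simp: measure_claim_atMost)
    also have "space claim - {..x} = {x<..}"
      by auto
    finally have *: "emeasure claim {x<..} = ennreal (1 - F x)"
      by (simp add: claim.emeasure_eq_measure)
    have "(\<integral>\<^sup>+z. ennreal (L * exp (L * x)) * indicator {0..<z} x \<partial>claim) =
        (\<integral>\<^sup>+z. ennreal (L * exp (L * x)) * indicator {0..} x * indicator {x<..} z \<partial>claim)"
      by (intro nn_integral_cong) (auto split: split_indicator)
    also have "\<dots> = ennreal (L * exp (L * x)) * indicator {0..} x * ennreal (1 - F x)"
      by (simp add: nn_integral_cmult_indicator *)
    also have "\<dots> = ennreal L * (ennreal (exp (L * x)) * ennreal (1 - F x) * indicator {0..} x)"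
      using \<open>0 < L\<close> by (simp add: ennreal_mult' mult_ac)
    also have "ennreal (exp (L * x)) * ennreal (1 - F x) = ennreal (exp (L * x) * (1 - F x))"
      by (rule ennreal_mult'[symmetric]) simp
    finally show "(\<integral>\<^sup>+z. ennreal (L * exp (L * x)) * indicator {0..<z} x \<partial>claim) =
        ennreal L * (ennreal (exp (L * x) * (1 - F x)) * indicator {0..} x)" .
  qed
  also have "\<dots> = ennreal L * (\<integral>\<^sup>+x. ennreal (exp (L * x) * (1 - F x)) * indicator {0..} x \<partial>lborel)"
  proof (rule nn_integral_cmult)
    have [measurable]: "F \<in> borel_measurable borel"
      by (rule borel_measurable_mono) (simp add: mono_def F_mono)
    show "(\<lambda>x. ennreal (exp (L * x) * (1 - F x)) * indicator {0..} x) \<in> borel_measurable lborel"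
      by measurable
  qed
  finally show ?thesis .
qed

text \<open>Exponential tilting: multiplying the density of rate \<open>\<alpha>\<close> by
  \<open>exp (- r * t)\<close> gives \<open>\<alpha> / (\<alpha> + r)\<close> times the density of
  rate \<open>\<alpha> + r\<close>, which has total mass 1.\<close>

lemma waiting_laplace_transform:
  assumes "0 \<le> r"
  shows "(\<integral>\<^sup>+t. exp (- r * t) \<partial>waiting) = ennreal (\<alpha> / (\<alpha> + r))"
proof -
  have pos: "0 < \<alpha> + r"
    using alpha_pos assms by simp
  interpret P: prob_space "density lborel (exponential_density (\<alpha> + r))"
    by (rule prob_space_exponential_density[OF pos])
  have "(\<integral>\<^sup>+t. exp (- r * t) \<partial>waiting) =
      (\<integral>\<^sup>+t. ennreal (exponential_density \<alpha> t) * ennreal (exp (- r * t)) \<partial>lborel)"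
    by (rule nn_integral_density) auto
  also have "\<dots> = (\<integral>\<^sup>+t. ennreal (\<alpha> / (\<alpha> + r)) * ennreal (exponential_density (\<alpha> + r) t) \<partial>lborel)"
  proof (rule nn_integral_cong)
    fix t :: real
    have "exponential_density \<alpha> t * exp (- r * t) =
        \<alpha> / (\<alpha> + r) * exponential_density (\<alpha> + r) t"
    proof (cases "t < 0")
      case False
      have "exp (- t * \<alpha>) * exp (- r * t) = exp (- t * (\<alpha> + r))"
        by (simp add: algebra_simps flip: exp_add)
      then show ?thesis
        using False pos by (simp add: exponential_density_def)
    qed (simp add: exponential_density_def)
    then show "ennreal (exponential_density \<alpha> t) * ennreal (exp (- r * t)) =
        ennreal (\<alpha> / (\<alpha> + r)) * ennreal (exponential_density (\<alpha> + r) t)"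
      using alpha_pos pos exponential_density_nonneg[OF alpha_pos, of t]
        exponential_density_nonneg[OF pos, of t]
      by (simp flip: ennreal_mult)
  qed
  also have "\<dots> = ennreal (\<alpha> / (\<alpha> + r)) * (\<integral>\<^sup>+t. ennreal (exponential_density (\<alpha> + r) t) \<partial>lborel)"
    by (rule nn_integral_cmult) simp
  also have "(\<integral>\<^sup>+t. ennreal (exponential_density (\<alpha> + r) t) \<partial>lborel) = 1"
    using P.emeasure_space_1 by (simp add: emeasure_density)
  finally show ?thesis
    by simp
qed

end

section \<open>The lower barrier\<close>

lemma mono_on_phi_star:
  assumes "0 < L"
  shows "mono_on {0..} (phi_star L us)"
  unfolding phi_star_def using assms
  by (intro mono_onI max.mono diff_left_mono order_refl) simp

lemma unit_fun_phi_star: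
  assumes "0 < L"
  shows "unit_fun (phi_star L us)"
  using mono_on_phi_star[OF assms] by (rule unit_fun_mono_on) (auto simp: phi_star_def)

lemma tendsto_phi_star:
  assumes "0 < L"
  shows "(phi_star L us \<longlongrightarrow> 1) at_top"
proof -
  have "filterlim (\<lambda>u. L * (u - us)) at_top at_top"
    using assms filterlim_tendsto_add_at_top[OF tendsto_const[of "- us"] filterlim_ident]
    by (intro filterlim_tendsto_pos_mult_at_top[OF tendsto_const]) auto
  then have "((\<lambda>u. exp (- L * (u - us))) \<longlongrightarrow> 0) at_top"
    by (intro filterlim_compose[OF exp_at_bot])
      (simp add: filterlim_uminus_at_bot)
  then have "((\<lambda>u. max 0 (1 - exp (- L * (u - us)))) \<longlongrightarrow> max 0 (1 - 0)) at_top"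
    by (intro tendsto_intros)
  then show ?thesis
    by (simp add: phi_star_def[abs_def])
qed

text \<open>Replacing the positive part by \<open>1 - e\<^bsup>-L(w - us)\<^esup>\<close> makes the two integrations separate,
  and the tail condition says exactly that their product is at most \<open>1\<close>.\<close>

lemma (in risk_process) phi_star_le_opA:
  assumes us: "0 \<le> us" and cs: "0 < cs" and L: "0 < L"
    and lower: "\<And>u t. us \<le> u \<Longrightarrow> 0 \<le> t \<Longrightarrow> u + cs * t \<le> U u t"
    and integrable: "set_integrable lborel {0..} (\<lambda>z. exp (L * z) * (1 - F z))"
    and bound: "(\<alpha> / cs) * (LINT z:{0..}|lborel. exp (L * z) * (1 - F z)) \<le> 1"
    and u: "0 \<le> u"
  shows "phi_star L us u \<le> opA \<alpha> F U (phi_star L us) u"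
proof (cases "us \<le> u")
  case False
  then have "phi_star L us u = 0"
    using L by (simp add: phi_star_def max_def not_le mult_less_0_iff)
  then show ?thesis
    using unit_fun_nonneg[OF unit_fun_opA[OF unit_fun_phi_star[OF L]] u] by simp
next
  case True
  note unit = unit_fun_phi_star[OF L, of us]
  have F_le_1: "F x \<le> 1" for x
    using claim.prob_le_1[of "{..x}"] by (simp add: measure_claim_atMost)
  define I where "I = (LINT z:{0..}|lborel. exp (L * z) * (1 - F z))"
  have "(\<integral>\<^sup>+x. ennreal (exp (L * x) * (1 - F x)) * indicator {0..} x \<partial>lborel) = ennreal I"
    unfolding I_def using integrable F_le_1
    by (subst nn_integral_set_ennreal)
      (simp add: set_integrable_def set_lebesgue_integral_def nn_integral_eq_integral mult.commute)
  \<comment> \<open>The tail condition in the form \<open>I \<le> cs / \<alpha>\<close>.\<close>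
  moreover have "L * I \<le> L * (cs / \<alpha>)"
    using bound alpha_pos cs L by (intro mult_left_mono) (simp_all add: I_def field_simps)
  ultimately have moment: "(\<integral>\<^sup>+z. exp (L * z) \<partial>claim) \<le> ennreal (1 + L * (cs / \<alpha>))"
    using L alpha_pos cs
    by (simp add: claim_exponential_moment ennreal_leI ennreal_plus flip: ennreal_mult')
  let ?\<psi> = "\<lambda>p. zero_ext (phi_star L us) (after_claim u p)"
  \<comment> \<open>The complement is estimated from above: it is an integral of a nonnegative
    function, so the exponential majorant needs no separate integrability proof.\<close>
  have "ennreal (1 - opA \<alpha> F U (phi_star L us) u) = ennreal (\<integral>p. 1 - ?\<psi> p \<partial>waiting_claim)"
    using integrable_after_claim[OF unit, of u]
    by (simp add: opA_eq[OF unit u] waiting_claim.P.prob_space)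
  also have "\<dots> = (\<integral>\<^sup>+p. ennreal (1 - ?\<psi> p) \<partial>waiting_claim)"
    using integrable_after_claim[OF unit, of u] zero_ext_le_1[OF unit]
    by (intro nn_integral_eq_integral[symmetric]) auto
  also have "\<dots> \<le> (\<integral>\<^sup>+p. ennreal (exp (- L * (u - us))) *
      (ennreal (exp (- (L * cs) * fst p)) * ennreal (exp (L * snd p))) \<partial>waiting_claim)"
  proof (rule nn_integral_mono_AE)
    show "AE p in waiting_claim. ennreal (1 - ?\<psi> p) \<le> ennreal (exp (- L * (u - us))) *
      (ennreal (exp (- (L * cs) * fst p)) * ennreal (exp (L * snd p)))"
      using AE_waiting_claim
    proof eventually_elim
      case (elim p)
      let ?w = "after_claim u p"
      \<comment> \<open>After ruin the left side is 1, and the exponential is at least 1 because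
        \<open>?w < 0 \<le> us\<close>. Otherwise the positive part is dropped.\<close>
      have "1 - ?\<psi> p \<le> exp (- L * (?w - us))"
        using us L by (cases "0 \<le> ?w") (auto simp: phi_star_def mult_le_0_iff)
      also have "\<dots> \<le> exp (- L * (u - us) + (- (L * cs) * fst p + L * snd p))"
        using lower[OF True, of "fst p"] elim u L mult_left_mono[of "u + cs * fst p" "U u (fst p)" L]
        by (simp add: after_claim_def reserve_def algebra_simps)
      also have "\<dots> = exp (- L * (u - us)) * (exp (- (L * cs) * fst p) * exp (L * snd p))"
        by (simp only: exp_add)
      finally show ?case
        by (simp flip: ennreal_mult add: ennreal_leI)
    qed
  qed
  also have "\<dots> = ennreal (exp (- L * (u - us))) *
      ((\<integral>\<^sup>+t. exp (- (L * cs) * t) \<partial>waiting) * (\<integral>\<^sup>+z. exp (L * z) \<partial>claim))"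
    by (subst claim.nn_integral_fst[symmetric])
      (simp_all add: nn_integral_cmult nn_integral_multc)
  also have "\<dots> \<le> ennreal (exp (- L * (u - us))) *
      (ennreal (\<alpha> / (\<alpha> + L * cs)) * ennreal (1 + L * (cs / \<alpha>)))"
    using L cs by (intro mult_left_mono mult_mono moment) (auto simp: waiting_laplace_transform[of "L * cs", simplified])
  also have "\<dots> = ennreal (exp (- L * (u - us)) * (\<alpha> / (\<alpha> + L * cs) * (1 + L * (cs / \<alpha>))))"
    using L cs alpha_pos by (simp only: ennreal_mult' exp_ge_zero less_imp_le divide_nonneg_nonneg
        add_nonneg_nonneg mult_nonneg_nonneg)
  \<comment> \<open>The Laplace transform at \<open>L * cs\<close> and the bound on the claim moment
    are exact reciprocals.\<close>
  also have "\<alpha> / (\<alpha> + L * cs) * (1 + L * (cs / \<alpha>)) = 1"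
  proof -
    have "0 < \<alpha> + L * cs"
      using L cs alpha_pos by (simp add: add_pos_pos)
    moreover have "1 + L * (cs / \<alpha>) = (\<alpha> + L * cs) / \<alpha>"
      using alpha_pos by (simp add: field_simps)
    ultimately show ?thesis
      using alpha_pos by simp
  qed
  finally have "1 - opA \<alpha> F U (phi_star L us) u \<le> exp (- L * (u - us))"
    by simp
  then show ?thesis
    using unit_fun_nonneg[OF unit_fun_opA[OF unit] u] by (simp add: phi_star_def)
qed

section \<open>Extremal fixed points and convergence of the iterates\<close>

theorem theorem4p1:
  fixes \<alpha> \<mu> us cs L :: real
    and F c :: "real \<Rightarrow> real"
    and U :: "real \<Rightarrow> real \<Rightarrow> real"
  assumes alpha_pos: "\<alpha> > 0"
    and F_df: "distribution_function F"
    and F_zero: "\<And>z. z \<le> 0 \<Longrightarrow> F z = 0"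
    and F_mean: "has_bochner_integral (interval_measure F) (\<lambda>z. z) \<mu>"
    and c_nonneg: "\<And>u. u \<ge> 0 \<Longrightarrow> c u \<ge> 0"
    and c_pc: "piecewise_continuous_half_line c"
    and U_flow: "is_flow c U"
    and U_mono_u: "\<And>t. t \<ge> 0 \<Longrightarrow> mono_on {0..} (\<lambda>u. U u t)"
    and U_mono_t: "\<And>u. u \<ge> 0 \<Longrightarrow> mono_on {0..} (\<lambda>t. U u t)"
    and U_lim: "\<And>u. u \<ge> 0 \<Longrightarrow> filterlim (\<lambda>t. U u t) at_top at_top"
    and us_nonneg: "us \<ge> 0"
    and cs_pos: "cs > 0"
    and L_pos: "L > 0"
    and U_lower: "\<And>u t. u \<ge> us \<Longrightarrow> t \<ge> 0 \<Longrightarrow> U u t \<ge> u + cs * t"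
    and tail_integrable: "set_integrable lborel {0..} (\<lambda>z. exp (L * z) * (1 - F z))"
    and tail_bound: "(\<alpha> / cs) * (LINT z:{0..}|lborel. exp (L * z) * (1 - F z)) \<le> 1"
  shows "\<exists>\<phi> :: real \<Rightarrow> real.
      (nondecreasing_solution \<alpha> F U \<phi> \<and>
       (\<forall>u\<ge>0. phi_star L us u \<le> \<phi> u \<and> \<phi> u \<le> 1)) \<and>
      ((\<phi> \<longlongrightarrow> 1) at_top \<and>
       (\<forall>\<psi>. nondecreasing_solution \<alpha> F U \<psi> \<and> (\<forall>u\<ge>0. 0 \<le> \<psi> u \<and> \<psi> u \<le> 1) \<and>
             (\<psi> \<longlongrightarrow> 1) at_top \<longrightarrow> (\<forall>u\<ge>0. \<psi> u = \<phi> u))) \<and>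
      (\<forall>\<phi>0. \<phi>0 \<in> borel_measurable (restrict_space borel {0..}) \<and>
             (\<forall>u\<ge>0. phi_star L us u \<le> \<phi>0 u \<and> \<phi>0 u \<le> 1) \<longrightarrow>
         (\<forall>u\<ge>0. (\<lambda>k. (opA \<alpha> F U ^^ k) \<phi>0 u) \<longlonglongrightarrow> \<phi> u))"
proof -
  have flow: "cauchy_solution c u (U u)" if "0 \<le> u" for u
    using U_flow that by (simp add: is_flow_def)
  interpret risk_process \<alpha> F U
  proof
    show "0 \<le> U u t" if "0 \<le> u" "0 \<le> t" for u t
      using flow[OF that(1)] that(2) by (simp add: cauchy_solution_def)
    show "continuous_on {0..} (U u)" if "0 \<le> u" for u
      using flow[OF that] by (simp add: cauchy_solution_def)
  qed (fact alpha_pos F_df F_zero U_mono_u)+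
  let ?A = "opA \<alpha> F U" and ?\<phi>s = "phi_star L us" and ?one = "\<lambda>_::real. 1::real"
  define lo where "lo k = (?A ^^ k) ?\<phi>s" for k
  define hi where "hi k = (?A ^^ k) ?one" for k
  note unit_star = unit_fun_phi_star[OF L_pos, of us]
  have unit_one: "unit_fun ?one"
    by (simp add: unit_fun_def)
  have unit_lo: "unit_fun (lo k)" for k
    unfolding lo_def by (rule unit_fun_opA_iterate[OF unit_star])
  have unit_hi: "unit_fun (hi k)" for k
    unfolding hi_def by (rule unit_fun_opA_iterate[OF unit_one])
  \<comment> \<open>Iterate \<open>k + 1\<close> is read as iterate \<open>k\<close> started from
    the image of \<open>?\<phi>s\<close>, so the single comparison of \<open>?\<phi>s\<close> with
    its image propagates to all \<open>k\<close>.\<close>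
  have lo_Suc: "lo k u \<le> lo (Suc k) u" if "0 \<le> u" for k u
    unfolding lo_def funpow_Suc_right comp_def
    by (rule opA_iterate_mono[OF unit_star unit_fun_opA[OF unit_star] _ that])
      (rule phi_star_le_opA[OF us_nonneg cs_pos L_pos U_lower tail_integrable tail_bound])
  have hi_Suc: "hi (Suc k) u \<le> hi k u" if "0 \<le> u" for k u
    unfolding hi_def funpow_Suc_right comp_def
    by (rule opA_iterate_mono[OF unit_fun_opA[OF unit_one] unit_one _ that])
      (rule unit_fun_le_1[OF unit_fun_opA[OF unit_one]])
  define \<phi>l where "\<phi>l u = lim (\<lambda>k. lo k u)" for u
  define \<phi> where "\<phi> u = lim (\<lambda>k. hi k u)" for u
  have lo_lim: "(\<lambda>k. lo k u) \<longlonglongrightarrow> \<phi>l u" if "0 \<le> u" for u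
    unfolding \<phi>l_def convergent_LIMSEQ_iff[symmetric]
    by (intro Bseq_monoseq_convergent BseqI'[of _ 1])
      (use that lo_Suc unit_fun_nonneg[OF unit_lo] unit_fun_le_1[OF unit_lo] in \<open>auto simp: monoseq_Suc\<close>)
  have hi_lim: "(\<lambda>k. hi k u) \<longlonglongrightarrow> \<phi> u" if "0 \<le> u" for u
    unfolding \<phi>_def convergent_LIMSEQ_iff[symmetric]
    by (intro Bseq_monoseq_convergent BseqI'[of _ 1])
      (use that hi_Suc unit_fun_nonneg[OF unit_hi] unit_fun_le_1[OF unit_hi] in \<open>auto simp: monoseq_Suc\<close>)
  have unit_\<phi>l: "unit_fun \<phi>l"
    using unit_lo lo_lim by (rule unit_fun_LIMSEQ)
  have unit_\<phi>: "unit_fun \<phi>"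
    using unit_hi hi_lim by (rule unit_fun_LIMSEQ)
  have fix_\<phi>l: "\<phi>l u = ?A \<phi>l u" if "0 \<le> u" for u
  proof (rule LIMSEQ_unique)
    show "(\<lambda>k. lo (Suc k) u) \<longlonglongrightarrow> \<phi>l u"
      by (rule LIMSEQ_Suc[OF lo_lim[OF that]])
    show "(\<lambda>k. lo (Suc k) u) \<longlonglongrightarrow> ?A \<phi>l u"
      using opA_LIMSEQ[OF unit_lo lo_lim that] by (simp add: lo_def)
  qed
  have fix_\<phi>: "\<phi> u = ?A \<phi> u" if "0 \<le> u" for u
  proof (rule LIMSEQ_unique)
    show "(\<lambda>k. hi (Suc k) u) \<longlonglongrightarrow> \<phi> u"
      by (rule LIMSEQ_Suc[OF hi_lim[OF that]])
    show "(\<lambda>k. hi (Suc k) u) \<longlonglongrightarrow> ?A \<phi> u"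
      using opA_LIMSEQ[OF unit_hi hi_lim that] by (simp add: hi_def)
  qed
  have star_le_\<phi>l: "?\<phi>s u \<le> \<phi>l u" if "0 \<le> u" for u
  proof -
    have "incseq (\<lambda>k. lo k u)"
      using lo_Suc[OF that] by (rule incseq_SucI)
    from incseq_le[OF this lo_lim[OF that], of 0] show ?thesis
      by (simp add: lo_def)
  qed
  \<comment> \<open>A fixed point stays below every iterate of the constant 1, by induction; hence
    \<open>\<phi>\<close> is the greatest fixed point among unit functions.\<close>
  have le_\<phi>: "\<psi> u \<le> \<phi> u"
    if \<psi>: "unit_fun \<psi>" and fp: "\<And>v. 0 \<le> v \<Longrightarrow> \<psi> v = ?A \<psi> v" and "0 \<le> u" for \<psi> u
  proof -
    have "\<psi> u \<le> hi k u" if "0 \<le> u" for k u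
      using that
    proof (induction k arbitrary: u)
      case 0
      then show ?case
        using unit_fun_le_1[OF \<psi>] by (simp add: hi_def)
    next
      case (Suc k)
      then show ?case
        using opA_mono[OF \<psi> unit_hi[of k] Suc.IH, of u] fp[of u] by (simp add: hi_def)
    qed
    with hi_lim[OF \<open>0 \<le> u\<close>] show ?thesis
      using \<open>0 \<le> u\<close> by (intro LIMSEQ_le_const) auto
  qed
  have \<phi>l_le_\<phi>: "\<phi>l u \<le> \<phi> u" if "0 \<le> u" for u
    using le_\<phi>[OF unit_\<phi>l fix_\<phi>l that] .
  have tendsto_1: "(\<psi> \<longlongrightarrow> 1) at_top" if "unit_fun \<psi>" "\<And>u. 0 \<le> u \<Longrightarrow> ?\<phi>s u \<le> \<psi> u" for \<psi>
  proof (rule tendsto_sandwich[OF _ _ tendsto_phi_star[OF L_pos] tendsto_const])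
    show "\<forall>\<^sub>F u in at_top. ?\<phi>s u \<le> \<psi> u" "\<forall>\<^sub>F u in at_top. \<psi> u \<le> 1"
      using that(2) unit_fun_le_1[OF that(1)]
      by (auto intro!: eventually_at_top_linorderI[of 0])
  qed
  have \<phi>_lim: "(\<phi> \<longlongrightarrow> 1) at_top"
    using unit_\<phi> star_le_\<phi>l \<phi>l_le_\<phi> by (intro tendsto_1) (auto intro: order_trans)
  \<comment> \<open>Stated for measurable rather than monotone \<open>\<psi>\<close>, so that it
    also covers \<open>\<phi>l\<close>. Maximality of \<open>\<phi>\<close> makes the difference
    nonnegative, linearity makes it a fixed point, and the two limits make it vanish at
    infinity.\<close>
  have unique: "\<psi> u = \<phi> u"
    if \<psi>: "unit_fun \<psi>" and fp: "\<And>v. 0 \<le> v \<Longrightarrow> \<psi> v = ?A \<psi> v"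
      and lim: "(\<psi> \<longlongrightarrow> 1) at_top" and "0 \<le> u" for \<psi> u
  proof -
    have "\<phi> u - \<psi> u = 0"
    proof (rule opA_fixed_point_vanishing[where d = "\<lambda>v. \<phi> v - \<psi> v"])
      show "unit_fun (\<lambda>v. \<phi> v - \<psi> v)"
        using unit_\<phi> \<psi> le_\<phi>[OF \<psi> fp] by (rule unit_fun_diff)
      show "\<phi> v - \<psi> v = ?A (\<lambda>v. \<phi> v - \<psi> v) v" if "0 \<le> v" for v
        using opA_diff[OF unit_\<phi> \<psi> le_\<phi>[OF \<psi> fp] that] fix_\<phi>[OF that] fp[OF that] by simp
      show "((\<lambda>v. \<phi> v - \<psi> v) \<longlongrightarrow> 0) at_top"
        using tendsto_diff[OF \<phi>_lim lim] by simp
    qed (use U_mono_t[of 0] U_lim[of 0] \<open>0 \<le> u\<close> in auto)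
    then show ?thesis
      by simp
  qed
  have \<phi>l_eq: "\<phi>l u = \<phi> u" if "0 \<le> u" for u
    using unique[OF unit_\<phi>l fix_\<phi>l tendsto_1[OF unit_\<phi>l star_le_\<phi>l] that] .
  \<comment> \<open>Monotonicity is inherited from the iterates of a constant.\<close>
  have mono_\<phi>: "mono_on {0..} \<phi>"
  proof (rule mono_onI)
    fix u v :: real
    assume uv: "u \<in> {0..}" "v \<in> {0..}" "u \<le> v"
    have "hi k u \<le> hi k v" for k
      unfolding hi_def
      by (rule mono_onD[OF mono_on_opA_iterate[OF unit_one] uv]) (simp add: mono_on_def)
    then show "\<phi> u \<le> \<phi> v"
      using uv by (intro LIMSEQ_le[OF hi_lim hi_lim]) auto
  qed
  show ?thesis
  proof (intro exI[of _ \<phi>] conjI allI impI)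
    show "nondecreasing_solution \<alpha> F U \<phi>"
      using mono_\<phi> fix_\<phi> by (simp add: nondecreasing_solution_def)
    show "?\<phi>s u \<le> \<phi> u" "\<phi> u \<le> 1" if "0 \<le> u" for u
      using star_le_\<phi>l[OF that] \<phi>l_le_\<phi>[OF that] unit_fun_le_1[OF unit_\<phi> that] by auto
    show "(\<phi> \<longlongrightarrow> 1) at_top"
      by (rule \<phi>_lim)
    show "\<psi> u = \<phi> u"
      if "nondecreasing_solution \<alpha> F U \<psi> \<and> (\<forall>u\<ge>0. 0 \<le> \<psi> u \<and> \<psi> u \<le> 1) \<and> (\<psi> \<longlongrightarrow> 1) at_top"
        and "0 \<le> u" for \<psi> u
    proof (rule unique)
      \<comment> \<open>A monotone competitor is Borel on the half-line, which is where its
        measurability comes from.\<close>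
      show "unit_fun \<psi>"
        using that(1) unfolding nondecreasing_solution_def by (intro unit_fun_mono_on) blast+
      show "\<psi> v = ?A \<psi> v" if "0 \<le> v" for v
        using \<open>nondecreasing_solution \<alpha> F U \<psi> \<and> _\<close> that
        unfolding nondecreasing_solution_def by blast
    qed (use that in blast)+
    fix \<phi>0 :: "real \<Rightarrow> real" and u :: real
    assume \<phi>0: "\<phi>0 \<in> borel_measurable (restrict_space borel {0..}) \<and>
        (\<forall>u\<ge>0. ?\<phi>s u \<le> \<phi>0 u \<and> \<phi>0 u \<le> 1)" and "0 \<le> u"
    have unit_\<phi>0: "unit_fun \<phi>0"
      using \<phi>0 unit_fun_nonneg[OF unit_star] by (auto simp: unit_fun_def intro: order_trans)
    show "(\<lambda>k. (?A ^^ k) \<phi>0 u) \<longlonglongrightarrow> \<phi> u"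
    proof (rule real_tendsto_sandwich)
      show "\<forall>\<^sub>F k in sequentially. lo k u \<le> (?A ^^ k) \<phi>0 u"
        unfolding lo_def using \<phi>0 \<open>0 \<le> u\<close>
        by (intro always_eventually allI opA_iterate_mono unit_star unit_\<phi>0) auto
      show "\<forall>\<^sub>F k in sequentially. (?A ^^ k) \<phi>0 u \<le> hi k u"
        unfolding hi_def using \<phi>0 \<open>0 \<le> u\<close>
        by (intro always_eventually allI opA_iterate_mono unit_one unit_\<phi>0) auto
      show "(\<lambda>k. lo k u) \<longlonglongrightarrow> \<phi> u" "(\<lambda>k. hi k u) \<longlonglongrightarrow> \<phi> u"
        using lo_lim hi_lim \<phi>l_eq \<open>0 \<le> u\<close> by auto
    qed
  qed
qed

end
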